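(* Let $G$ be a countable infinite residually finite discrete group and let $T=(T_g)_{g\in G}$ be an ergodic nonsingular $G$-action on a standard nonatomic probability space $(X,\mathfrak B,\mu)$. Let $\Gamma_1\supsetneq\Gamma_2\supsetneq\cdots$ be a sequence of finite-index subgroups of $G$ such that $\bigcap_{n=1}^\infty\bigcap_{g\in G}g\Gamma_ng^{-1}=\{1_G\}$, and let $(Y,O)$ be the topological $G$-odometer associated with this sequence. Suppose that for each $n\in\mathbb N$ there exists a factor of $T$ which is isomorphic to the homogeneous $G$-space $G/\Gamma_n$. Then there is an $O$-quasi-invariant measure $\nu$ on $Y$ such that the nonsingular odometer $(Y,\nu,O)$ is a factor of $(X,\mu,T)$.
   Context: The topological $G$-odometer associated with $(\Gamma_n)_n$ is $Y=\varprojlim G/\Gamma_n$ (sequences $(g_n\Gamma_n)_n$ with $g_n\Gamma_n=g_{n+1}\Gamma_n$, with the projective limit topology) with the $G$-action $O_g(g_n\Gamma_n)_n=(gg_n\Gamma_n)_n$. A nonsingular $G$-odometer is a system $(Y,\nu,O)$, where $(Y,O)$ is a topological $G$-odometer and $\nu$ is a non-atomic Borel measure on $Y$ which is quasi-invariant and ergodic under $O$. A factor of $(X,\mu,T)$ is a $T$-invariant sub-$\sigma$-algebra of $\mathfrak B$ or, equivalently, a nonsingular system that is the image of $(X,\mu,T)$ under a measurable, a.e. $G$-equivariant nonsingular map; $G/\Gamma_n$ carries the left translation action and is a factor iff there is a measurable a.e. $G$-equivariant map $X\to G/\Gamma_n$.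
   Formalization: As stated this fails if ν must be non-atomic (an action induced from a subgroup of the Heisenberg group). Proved: an ergodic quasi-invariant ν with (Y,ν,O) a factor always exists; ν is non-atomic if T has no factor isomorphic to G/Stab(y), y in Y, with Stab(y) infinite. *)

theory Defs
  imports
    "HOL-Probability.Probability"
    "HOL-Algebra.Group_Action"
    "HOL-Algebra.Left_Coset"
begin

definition residually_finite :: "('g, 'b) monoid_scheme \<Rightarrow> bool" where
  "residually_finite G \<longleftrightarrow>
     (\<forall>g\<in>carrier G - {\<one>\<^bsub>G\<^esub>}. \<exists>N. N \<lhd> G \<and> finite (rcosets\<^bsub>G\<^esub> N) \<and> g \<notin> N)"

definition borel_sets :: "'a topology \<Rightarrow> 'a set set" where
  "borel_sets \<tau> = sigma_sets (topspace \<tau>) {U. openin \<tau> U}"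

definition standard_borel :: "'a measure \<Rightarrow> bool" where
  "standard_borel M \<longleftrightarrow>
     (\<exists>\<tau>. completely_metrizable_space \<tau> \<and> second_countable \<tau> \<and>
          topspace \<tau> = space M \<and> sets M = borel_sets \<tau>)"

definition nonatomic :: "'a measure \<Rightarrow> bool" where
  "nonatomic M \<longleftrightarrow>
     \<not> (\<exists>A\<in>sets M. emeasure M A > 0 \<and>
          (\<forall>B\<in>sets M. B \<subseteq> A \<longrightarrow> emeasure M B = 0 \<or> emeasure M (A - B) = 0))"

text \<open>Only the measure class matters for nonsingular systems, so requiring a probability
  measure is just a normalization of a sigma-finite one. The locale \<open>group_action\<close> asks that
  each \<open>T g\<close> be a bijection of \<open>space M\<close>, extended by \<open>undefined\<close> outside.\<close>

definition nonsingular_system ::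
    "('g, 'b) monoid_scheme \<Rightarrow> 'x measure \<Rightarrow> ('g \<Rightarrow> 'x \<Rightarrow> 'x) \<Rightarrow> bool" where
  "nonsingular_system G M T \<longleftrightarrow>
     prob_space M \<and> group_action G (space M) T \<and>
     (\<forall>g\<in>carrier G. T g \<in> measurable M M \<and>
        (\<forall>A\<in>sets M. emeasure M (T g -` A \<inter> space M) = 0 \<longleftrightarrow> emeasure M A = 0))"

definition ergodic ::
    "('g, 'b) monoid_scheme \<Rightarrow> 'x measure \<Rightarrow> ('g \<Rightarrow> 'x \<Rightarrow> 'x) \<Rightarrow> bool" where
  "ergodic G M T \<longleftrightarrow>
     (\<forall>A\<in>sets M. (\<forall>g\<in>carrier G. T g -` A \<inter> space M = A) \<longrightarrow>
        emeasure M A = 0 \<or> emeasure M (space M - A) = 0)"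

text \<open>Nonsingularity of \<open>\<phi>\<close> means that the image of the measure \<open>M\<close> under \<open>\<phi>\<close> has the same
  null sets as \<open>N\<close>.\<close>

definition is_factor ::
    "('g, 'b) monoid_scheme \<Rightarrow> 'x measure \<Rightarrow> ('g \<Rightarrow> 'x \<Rightarrow> 'x) \<Rightarrow>
     'y measure \<Rightarrow> ('g \<Rightarrow> 'y \<Rightarrow> 'y) \<Rightarrow> bool" where
  "is_factor G M T N S \<longleftrightarrow>
     nonsingular_system G N S \<and>
     (\<exists>\<phi>\<in>measurable M N.
        (\<forall>g\<in>carrier G. AE x in M. \<phi> (T g x) = S g (\<phi> x)) \<and>
        (\<forall>B\<in>sets N. emeasure M (\<phi> -` B \<inter> space M) = 0 \<longleftrightarrow> emeasure N B = 0))"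

definition coset_action :: "('g, 'b) monoid_scheme \<Rightarrow> 'g set \<Rightarrow> 'g \<Rightarrow> 'g set \<Rightarrow> 'g set" where
  "coset_action G H g = (\<lambda>C\<in>lcosets\<^bsub>G\<^esub> H. g <#\<^bsub>G\<^esub> C)"

text \<open>The countable space \<open>G/H\<close> is discrete and is considered with any of its quasi-invariant
  measures; these are all equivalent.\<close>

definition has_homogeneous_factor ::
    "('g, 'b) monoid_scheme \<Rightarrow> 'x measure \<Rightarrow> ('g \<Rightarrow> 'x \<Rightarrow> 'x) \<Rightarrow> 'g set \<Rightarrow> bool" where
  "has_homogeneous_factor G M T H \<longleftrightarrow>
     (\<exists>\<kappa>. sets \<kappa> = Pow (lcosets\<^bsub>G\<^esub> H) \<and> is_factor G M T \<kappa> (coset_action G H))"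

definition odometer_space :: "('g, 'b) monoid_scheme \<Rightarrow> (nat \<Rightarrow> 'g set) \<Rightarrow> (nat \<Rightarrow> 'g set) set"
  where
  "odometer_space G \<Gamma> =
     {(\<lambda>n. \<gamma> n <#\<^bsub>G\<^esub> \<Gamma> n) | \<gamma>.
        (\<forall>n. \<gamma> n \<in> carrier G) \<and>
        (\<forall>n. \<gamma> n <#\<^bsub>G\<^esub> \<Gamma> n = \<gamma> (Suc n) <#\<^bsub>G\<^esub> \<Gamma> n)}"

definition odometer_topology ::
    "('g, 'b) monoid_scheme \<Rightarrow> (nat \<Rightarrow> 'g set) \<Rightarrow> (nat \<Rightarrow> 'g set) topology" where
  "odometer_topology G \<Gamma> =
     subtopology (product_topology (\<lambda>n. discrete_topology (lcosets\<^bsub>G\<^esub> (\<Gamma> n))) UNIV)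
       (odometer_space G \<Gamma>)"

definition odometer_action ::
    "('g, 'b) monoid_scheme \<Rightarrow> (nat \<Rightarrow> 'g set) \<Rightarrow> 'g \<Rightarrow> (nat \<Rightarrow> 'g set) \<Rightarrow> nat \<Rightarrow> 'g set" where
  "odometer_action G \<Gamma> g = (\<lambda>y\<in>odometer_space G \<Gamma>. \<lambda>n. g <#\<^bsub>G\<^esub> y n)"

definition ergodic_odometer_measure ::
    "('g, 'b) monoid_scheme \<Rightarrow> (nat \<Rightarrow> 'g set) \<Rightarrow> (nat \<Rightarrow> 'g set) measure \<Rightarrow> bool" where
  "ergodic_odometer_measure G \<Gamma> \<nu> \<longleftrightarrow>
     sets \<nu> = borel_sets (odometer_topology G \<Gamma>) \<and>
     nonsingular_system G \<nu> (odometer_action G \<Gamma>) \<and>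
     ergodic G \<nu> (odometer_action G \<Gamma>)"

text \<open>Non-atomicity is kept separate because it can fail for every odometer factor of a nonatomic
  system. Let \<open>G\<close> be the integer Heisenberg group, with product
  \<open>(a,b,c)(a',b',c') = (a+a', b+b', c+c'+ab')\<close>, let \<open>\<Gamma> n\<close> consist of the elements with \<open>b\<close> and
  \<open>c\<close> divisible by \<open>2^n\<close>, and let \<open>H\<close> be the intersection of all \<open>\<Gamma> n\<close>, that is \<open>b = c = 0\<close>.
  The conjugates of \<open>H\<close> intersect trivially. Induce to \<open>G\<close> a weakly mixing action of the infinite
  cyclic group \<open>H\<close> on a nonatomic space \<open>Z\<close>. The result maps onto \<open>G/H\<close>, hence onto
  each \<open>G/\<Gamma> n\<close>; but an \<open>H\<close>-equivariant map from \<open>Z\<close> to a finite \<open>H\<close>-space is constant, so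
  every equivariant map to the odometer has an atomic image.\<close>

definition nonsingular_odometer ::
    "('g, 'b) monoid_scheme \<Rightarrow> (nat \<Rightarrow> 'g set) \<Rightarrow> (nat \<Rightarrow> 'g set) measure \<Rightarrow> bool" where
  "nonsingular_odometer G \<Gamma> \<nu> \<longleftrightarrow> ergodic_odometer_measure G \<Gamma> \<nu> \<and> nonatomic \<nu>"

end

theory Submission
  imports Defs
begin

text \<open>Two equivariant maps into the finite space \<open>G/\<Gamma> n\<close> agree almost everywhere or differ almost
  everywhere, by ergodicity. Hence there are only finitely many of them up to null sets, and a compactness
  argument produces equivariant maps \<open>X \<rightarrow> G/\<Gamma> n\<close> that are compatible with the projections.
  Together they form an equivariant map into the odometer, and \<open>\<nu>\<close> is the image of \<open>\<mu>\<close>.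
  An atom of \<open>\<nu>\<close> contains a point \<open>y\<close> of positive mass, whose orbit carries \<open>\<nu>\<close>, so that the
  homogeneous space of the stabilizer of \<open>y\<close> is a factor. The stabilizer is infinite, because it acts
  ergodically on the nonatomic fibre over \<open>y\<close>.\<close>

section \<open>Group actions and coset spaces\<close>

text \<open>Bijectivity comes for free: \<open>f (inv g)\<close> is a two-sided inverse of
  \<open>f g\<close>. Extensionality turns the pointwise composition law into an equality in
  \<open>BijGroup E\<close>.\<close>

lemma group_actionI:
  assumes "group G"
    and ext: "\<And>g. g \<in> carrier G \<Longrightarrow> f g \<in> extensional E"
    and closed: "\<And>g x. g \<in> carrier G \<Longrightarrow> x \<in> E \<Longrightarrow> f g x \<in> E"
    and one: "\<And>x. x \<in> E \<Longrightarrow> f \<one>\<^bsub>G\<^esub> x = x"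
    and mult: "\<And>g h x. g \<in> carrier G \<Longrightarrow> h \<in> carrier G \<Longrightarrow> x \<in> E \<Longrightarrow> f (g \<otimes>\<^bsub>G\<^esub> h) x = f g (f h x)"
  shows "group_action G E f"
proof -
  interpret group G by fact
  have Bij: "f g \<in> Bij E" if g: "g \<in> carrier G" for g
  proof -
    have "bij_betw (f g) E E"
    proof (rule bij_betw_byWitness[where f' = "f (inv\<^bsub>G\<^esub> g)"])
      show "\<forall>x\<in>E. f (inv\<^bsub>G\<^esub> g) (f g x) = x" "\<forall>x\<in>E. f g (f (inv\<^bsub>G\<^esub> g) x) = x"
        using g by (simp_all add: one flip: mult)
    qed (use g closed in auto)
    then show ?thesis
      using ext[OF g] by (simp add: Bij_def)
  qed
  have "f (g \<otimes>\<^bsub>G\<^esub> h) = compose E (f g) (f h)" if "g \<in> carrier G" "h \<in> carrier G" for g h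
    using that by (intro extensionalityI[where A = E]) (auto simp: ext mult compose_eq)
  then have "f \<in> hom G (BijGroup E)"
    using Bij by (auto simp: hom_def BijGroup_def)
  then show ?thesis
    by (simp add: group_action_def group_hom_def group_hom_axioms_def group_BijGroup group_axioms)
qed

lemma (in group_action) one_action: "x \<in> E \<Longrightarrow> \<phi> \<one> x = x"
  using id_eq_one by (metis restrict_apply')

context group
begin

lemma l_coset_mult_mem_lcosets:
  assumes "H \<subseteq> carrier G" "C \<in> lcosets H" "g \<in> carrier G"
  shows "g <# C \<in> lcosets H"
  using assms by (auto simp: LCOSETS_def lcos_m_assoc)

lemma group_action_coset_action:
  assumes H: "H \<subseteq> carrier G"
  shows "group_action G (lcosets H) (coset_action G H)"
proof (rule group_actionI)
  have sub: "C \<subseteq> carrier G" if "C \<in> lcosets H" for C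
    using that l_coset_subset_G[OF H] by (auto simp: LCOSETS_def)
  show "coset_action G H \<one> C = C" if "C \<in> lcosets H" for C
    using that sub by (simp add: coset_action_def lcos_mult_one)
  show "coset_action G H (g \<otimes> h) C = coset_action G H g (coset_action G H h C)"
    if "g \<in> carrier G" "h \<in> carrier G" "C \<in> lcosets H" for g h C
    using that sub l_coset_mult_mem_lcosets[OF H] by (simp add: coset_action_def lcos_m_assoc)
qed (auto simp: coset_action_def l_coset_mult_mem_lcosets[OF H] intro: is_group)

text \<open>Applied to two members of the chain, this makes the set product
  \<open>C <#> \<Gamma> n\<close> the canonical projection from a finer coset space onto a coarser
  one.\<close>

lemma subgroup_mult_absorb:
  assumes "subgroup K G" "H \<subseteq> K" "\<one> \<in> H"
  shows "H <#> K = K"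
proof
  show "H <#> K \<subseteq> K"
    using assms subgroup.m_closed[OF assms(1)] by (auto simp: set_mult_def)
  show "K \<subseteq> H <#> K"
  proof
    fix k assume "k \<in> K"
    then have "\<one> \<otimes> k = k"
      using subgroup.mem_carrier[OF assms(1)] by simp
    then show "k \<in> H <#> K"
      using \<open>k \<in> K\<close> assms(3) by (force simp: set_mult_def)
  qed
qed

end

section \<open>Ergodicity and equivariant maps modulo null sets\<close>

locale ergodic_nonsingular_action = group G for G (structure) +
  fixes M :: "'x measure" and T :: "'a \<Rightarrow> 'x \<Rightarrow> 'x"
  assumes countable_group: "countable (carrier G)"
    and nonsingular: "nonsingular_system G M T"
    and ergodic: "ergodic G M T"
begin

sublocale M: prob_space M
  using nonsingular by (simp add: nonsingular_system_def)

sublocale T: group_action G "space M" T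
  using nonsingular by (simp add: nonsingular_system_def)

lemma T_measurable: "g \<in> carrier G \<Longrightarrow> T g \<in> measurable M M"
  using nonsingular by (simp add: nonsingular_system_def)

lemma T_space: "g \<in> carrier G \<Longrightarrow> x \<in> space M \<Longrightarrow> T g x \<in> space M"
  by (rule T.element_image) auto

lemma emeasure_T_vimage_eq_0:
  "g \<in> carrier G \<Longrightarrow> A \<in> sets M \<Longrightarrow> emeasure M (T g -` A \<inter> space M) = 0 \<longleftrightarrow> emeasure M A = 0"
  using nonsingular by (simp add: nonsingular_system_def)

lemma AE_T:
  assumes g: "g \<in> carrier G" and P: "AE x in M. P x"
  shows "AE x in M. P (T g x)"
proof -
  obtain N where N: "N \<in> null_sets M" "{x \<in> space M. \<not> P x} \<subseteq> N"
    using P by (auto simp: eventually_ae_filter)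
  have "T g -` N \<inter> space M \<in> null_sets M"
    using N(1) g emeasure_T_vimage_eq_0[OF g] T_measurable[OF g] by (auto simp: null_sets_def)
  moreover have "{x \<in> space M. \<not> P (T g x)} \<subseteq> T g -` N \<inter> space M"
    using N(2) T_space[OF g] by auto
  ultimately show ?thesis
    by (rule AE_I')
qed

text \<open>\<open>ergodic\<close> speaks of strictly invariant sets, while sets defined through
  a.e. equivariant maps are invariant only up to null sets. The bridge is the set \<open>B\<close>
  of points whose whole orbit lies in \<open>A\<close>: it is strictly invariant, and since the
  group is countable it is measurable and differs from \<open>A\<close> by a null set.\<close>

lemma AE_in_or_notin:
  assumes A: "A \<in> sets M"
    and inv: "\<And>g. g \<in> carrier G \<Longrightarrow> AE x in M. T g x \<in> A \<longleftrightarrow> x \<in> A"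
  shows "(AE x in M. x \<in> A) \<or> (AE x in M. x \<notin> A)"
proof -
  define B where "B = (\<Inter>g\<in>carrier G. T g -` A \<inter> space M)"
  have [measurable]: "B \<in> sets M"
    unfolding B_def using countable_group A T_measurable by (intro sets.countable_INT') auto
  have B_iff: "x \<in> B \<longleftrightarrow> x \<in> space M \<and> (\<forall>g\<in>carrier G. T g x \<in> A)" for x
    by (auto simp: B_def)
  have "T h -` B \<inter> space M = B" if h: "h \<in> carrier G" for h
  proof -
    have "(\<forall>g\<in>carrier G. T g (T h x) \<in> A) \<longleftrightarrow> (\<forall>g\<in>carrier G. T g x \<in> A)" if "x \<in> space M" for x
    proof safe
      fix g assume *: "\<forall>g\<in>carrier G. T g (T h x) \<in> A" and g: "g \<in> carrier G"
      \<comment> \<open>Right translation by \<open>inv h\<close> permutes the group, so the orbit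
        condition at \<open>T h x\<close> is the one at \<open>x\<close>.\<close>
      have "T (g \<otimes> inv h) (T h x) = T g x"
        using g h that by (simp add: m_assoc flip: T.composition_rule)
      then show "T g x \<in> A"
        using * g h by (metis inv_closed m_closed)
    qed (use h that in \<open>simp flip: T.composition_rule\<close>)
    then show ?thesis
      using T_space[OF h] by (auto simp: B_iff)
  qed
  then have "emeasure M B = 0 \<or> emeasure M (space M - B) = 0"
    using ergodic by (simp add: ergodic_def)
  then have "(AE x in M. x \<notin> B) \<or> (AE x in M. x \<in> B)"
    by (auto simp: null_sets_def intro: AE_I'[of B] AE_I'[of "space M - B"])
  \<comment> \<open>At a point where all the equivalences hold, the orbit condition reduces to
    \<open>x \<in> A\<close>; \<open>one_closed\<close> supplies an element over which to
    quantify.\<close>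
  moreover have *: "AE x in M. x \<in> B \<longleftrightarrow> x \<in> A"
  proof -
    have "AE x in M. \<forall>g\<in>carrier G. T g x \<in> A \<longleftrightarrow> x \<in> A"
      using countable_group inv by (simp add: AE_ball_countable)
    then show ?thesis
    proof (rule AE_mp, intro AE_I2 impI)
      fix x assume "x \<in> space M" "\<forall>g\<in>carrier G. T g x \<in> A \<longleftrightarrow> x \<in> A"
      then show "x \<in> B \<longleftrightarrow> x \<in> A"
        using one_closed by (auto simp: B_iff)
    qed
  qed
  moreover have "(AE x in M. x \<notin> B) \<longleftrightarrow> (AE x in M. x \<notin> A)"
    by (rule eventually_subst) (use * in eventually_elim, simp)
  ultimately show ?thesis
    by (auto simp: eventually_subst[OF *])
qed

text \<open>For an image measure the null-set condition on the factor map holds by definition.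
  Quasi-invariance and ergodicity are inherited from \<open>M\<close>, because equivariance makes
  the preimage under \<open>\<phi>\<close> of a translated set agree a.e. with the translate of the
  preimage.\<close>

lemma image_measure_factor:
  assumes S: "group_action G (space N) S"
    and S_meas: "\<And>g. g \<in> carrier G \<Longrightarrow> S g \<in> measurable N N"
    and \<phi>[measurable]: "\<phi> \<in> measurable M N"
    and equiv: "\<And>g. g \<in> carrier G \<Longrightarrow> AE x in M. \<phi> (T g x) = S g (\<phi> x)"
  shows "is_factor G M T (distr M N \<phi>) S" and "ergodic G (distr M N \<phi>) S"
proof -
  interpret S: group_action G "space N" S by fact
  have vimage: "emeasure M (\<phi> -` (S g -` A \<inter> space N) \<inter> space M) = emeasure M (T g -` (\<phi> -` A \<inter> space M) \<inter> space M)"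
    if g: "g \<in> carrier G" and A: "A \<in> sets N" for g A
  proof (rule emeasure_eq_AE)
    show "AE x in M. x \<in> \<phi> -` (S g -` A \<inter> space N) \<inter> space M \<longleftrightarrow> x \<in> T g -` (\<phi> -` A \<inter> space M) \<inter> space M"
      using equiv[OF g] by (rule AE_mp) (use T_space[OF g] measurable_space[OF \<phi>] in auto)
    show "\<phi> -` (S g -` A \<inter> space N) \<inter> space M \<in> sets M"
      using measurable_sets[OF S_meas[OF g] A] by measurable
    show "T g -` (\<phi> -` A \<inter> space M) \<inter> space M \<in> sets M"
      using measurable_sets[OF \<phi> A] measurable_sets[OF T_measurable[OF g]] by blast
  qed
  have "nonsingular_system G (distr M N \<phi>) S"
    unfolding nonsingular_system_def
  proof (intro conjI ballI)
    show "prob_space (distr M N \<phi>)"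
      by (rule M.prob_space_distr) measurable
    fix g assume g: "g \<in> carrier G"
    show "S g \<in> measurable (distr M N \<phi>) (distr M N \<phi>)"
      using S_meas[OF g] by simp
    fix A assume A: "A \<in> sets (distr M N \<phi>)"
    have "emeasure (distr M N \<phi>) (S g -` A \<inter> space N) = emeasure M (T g -` (\<phi> -` A \<inter> space M) \<inter> space M)"
      using A measurable_sets[OF S_meas[OF g]] vimage[OF g] by (simp add: emeasure_distr)
    then show "emeasure (distr M N \<phi>) (S g -` A \<inter> space (distr M N \<phi>)) = 0 \<longleftrightarrow> emeasure (distr M N \<phi>) A = 0"
      using A emeasure_T_vimage_eq_0[OF g, of "\<phi> -` A \<inter> space M"] by (simp add: emeasure_distr)
  qed (use S in simp)
  then show "is_factor G M T (distr M N \<phi>) S"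
    unfolding is_factor_def using equiv by (auto simp: emeasure_distr intro!: bexI[of _ \<phi>])
  show "ergodic G (distr M N \<phi>) S"
    unfolding ergodic_def
  proof (intro ballI impI)
    fix A assume A: "A \<in> sets (distr M N \<phi>)"
      and inv: "\<forall>g\<in>carrier G. S g -` A \<inter> space (distr M N \<phi>) = A"
    have [measurable]: "A \<in> sets N" using A by simp
    have "(AE x in M. x \<in> \<phi> -` A \<inter> space M) \<or> (AE x in M. x \<notin> \<phi> -` A \<inter> space M)"
    proof (rule AE_in_or_notin)
      fix g assume g: "g \<in> carrier G"
      have "S g y \<in> A \<longleftrightarrow> y \<in> A" if "y \<in> space N" for y
        using inv g that by auto
      then show "AE x in M. T g x \<in> \<phi> -` A \<inter> space M \<longleftrightarrow> x \<in> \<phi> -` A \<inter> space M"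
        using equiv[OF g] by (elim AE_mp) (use T_space[OF g] measurable_space[OF \<phi>] in auto)
    qed measurable
    then have "(AE y in distr M N \<phi>. y \<in> A) \<or> (AE y in distr M N \<phi>. y \<notin> A)"
      by (auto simp: AE_distr_iff)
    then show "emeasure (distr M N \<phi>) A = 0 \<or> emeasure (distr M N \<phi>) (space (distr M N \<phi>) - A) = 0"
    proof
      assume "AE y in distr M N \<phi>. y \<in> A"
      then have "AE y in distr M N \<phi>. y \<notin> space (distr M N \<phi>) - A" by auto
      then show ?thesis
        using A by (subst (asm) AE_iff_null_sets[symmetric]) auto
    next
      assume "AE y in distr M N \<phi>. y \<notin> A"
      then show ?thesis
        using A by (subst (asm) AE_iff_null_sets[symmetric]) auto
    qed
  qed
qed

text \<open>The set where the two maps agree is invariant up to null sets: equivariance preserves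
  agreement, and injectivity of \<open>S g\<close> reflects it. Ergodicity then decides its
  measure.\<close>

lemma equivariant_maps_agree_or_differ:
  assumes S: "\<And>g. g \<in> carrier G \<Longrightarrow> inj_on (S g) C"
    and C: "countable C"
    and \<phi>[measurable]: "\<phi> \<in> measurable M (count_space C)"
    and \<psi>[measurable]: "\<psi> \<in> measurable M (count_space C)"
    and eq\<phi>: "\<And>g. g \<in> carrier G \<Longrightarrow> AE x in M. \<phi> (T g x) = S g (\<phi> x)"
    and eq\<psi>: "\<And>g. g \<in> carrier G \<Longrightarrow> AE x in M. \<psi> (T g x) = S g (\<psi> x)"
  shows "(AE x in M. \<phi> x = \<psi> x) \<or> (AE x in M. \<phi> x \<noteq> \<psi> x)"
proof -
  have range: "\<phi> x \<in> C" "\<psi> x \<in> C" if "x \<in> space M" for x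
    using that measurable_space[OF \<phi>] measurable_space[OF \<psi>] by auto
  define A where "A = {x \<in> space M. \<phi> x = \<psi> x}"
  \<comment> \<open>Splitting by the common value exhibits \<open>A\<close> as a countable union of
    measurable sets.\<close>
  have "A = (\<Union>c\<in>C. (\<phi> -` {c} \<inter> space M) \<inter> (\<psi> -` {c} \<inter> space M))"
    using range by (auto simp: A_def)
  also have "\<dots> \<in> sets M"
    using C by (intro sets.countable_UN') (auto intro!: sets.Int measurable_sets[OF \<phi>] measurable_sets[OF \<psi>])
  finally have "(AE x in M. x \<in> A) \<or> (AE x in M. x \<notin> A)"
  proof (rule AE_in_or_notin)
    fix g assume g: "g \<in> carrier G"
    show "AE x in M. T g x \<in> A \<longleftrightarrow> x \<in> A"
      using eq\<phi>[OF g] eq\<psi>[OF g] AE_space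
      by eventually_elim (use T_space[OF g] S[OF g] range in \<open>auto simp: A_def inj_on_eq_iff\<close>)
  qed
  then show ?thesis
    unfolding A_def by (elim disjE; intro disjI1 disjI2) (auto elim: AE_mp)
qed

end

section \<open>Topology and Borel structure of the odometer\<close>

text \<open>In a compatible sequence each coordinate determines all earlier ones. A basic open set
  of the product restricts finitely many coordinates, so on the odometer it contains, around each of
  its points, a cylinder given by a single coordinate.\<close>

lemma openin_odometer_topology_iff:
  assumes proj: "\<And>n y z. y \<in> odometer_space G \<Gamma> \<Longrightarrow> z \<in> odometer_space G \<Gamma> \<Longrightarrow> y (Suc n) = z (Suc n) \<Longrightarrow> y n = z n"
    and cosets: "\<And>n y. y \<in> odometer_space G \<Gamma> \<Longrightarrow> y n \<in> lcosets\<^bsub>G\<^esub> (\<Gamma> n)"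
  shows "openin (odometer_topology G \<Gamma>) U \<longleftrightarrow>
    U \<subseteq> odometer_space G \<Gamma> \<and> (\<forall>y\<in>U. \<exists>n. \<forall>z\<in>odometer_space G \<Gamma>. z n = y n \<longrightarrow> z \<in> U)"
    (is "?open U \<longleftrightarrow> ?cyl U")
proof
  let ?X = "product_topology (\<lambda>n. discrete_topology (lcosets\<^bsub>G\<^esub> (\<Gamma> n))) UNIV"
  show "?cyl U" if U: "?open U"
  proof (intro conjI ballI)
    obtain V where V: "openin ?X V" "U = V \<inter> odometer_space G \<Gamma>"
      using U by (auto simp: odometer_topology_def openin_subtopology)
    show "U \<subseteq> odometer_space G \<Gamma>" using V by auto
    fix y assume y: "y \<in> U"
    then have "y \<in> V" using V(2) by blast
    from V(1)[unfolded openin_product_topology_alt, THEN bspec, OF this]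
    obtain W where W: "finite {i. W i \<noteq> lcosets\<^bsub>G\<^esub> (\<Gamma> i)}" "y \<in> Pi\<^sub>E UNIV W" "Pi\<^sub>E UNIV W \<subseteq> V"
      by (elim exE conjE) simp
    from W(1) obtain n where "\<forall>i\<in>{i. W i \<noteq> lcosets\<^bsub>G\<^esub> (\<Gamma> i)}. i \<le> n"
      unfolding finite_nat_set_iff_bounded_le by (elim exE)
    then have n: "W i \<noteq> lcosets\<^bsub>G\<^esub> (\<Gamma> i) \<Longrightarrow> i \<le> n" for i by simp
    have "z \<in> U" if z: "z \<in> odometer_space G \<Gamma>" "z n = y n" for z
    proof -
      \<comment> \<open>Agreement descends from coordinate \<open>n\<close> to all smaller ones;
        beyond \<open>n\<close> the box \<open>W\<close> imposes no condition.\<close>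
      have eq: "z i = y i" if "i \<le> n" for i
        using that
      proof (induction rule: inc_induct)
        case (step i)
        then show ?case
          using proj[of z y i] z(1) y V(2) by blast
      qed (fact z(2))
      have "z i \<in> W i" for i
        using eq[of i] n[of i] W(2) cosets[OF z(1), of i] by (cases "i \<le> n") (auto simp: PiE_iff)
      then show ?thesis
        using W(3) V(2) z(1) by (auto simp: PiE_iff)
    qed
    then show "\<exists>n. \<forall>z\<in>odometer_space G \<Gamma>. z n = y n \<longrightarrow> z \<in> U" by blast
  qed
  assume U: "?cyl U"
  \<comment> \<open>The largest open set of the product whose trace on the odometer lies in
    \<open>U\<close>.\<close>
  let ?V = "\<Union>{V. openin ?X V \<and> V \<inter> odometer_space G \<Gamma> \<subseteq> U}"
  have "openin ?X ?V" by auto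
  moreover have "U = ?V \<inter> odometer_space G \<Gamma>"
  proof (intro subset_antisym subsetI)
    fix y assume y: "y \<in> U"
    then obtain n where n: "\<And>z. z \<in> odometer_space G \<Gamma> \<Longrightarrow> z n = y n \<Longrightarrow> z \<in> U"
      using U by blast
    have yY: "y \<in> odometer_space G \<Gamma>" using y U by blast
    let ?W = "{z \<in> topspace ?X. z n \<in> {y n}}"
    have "openin ?X ?W"
      using cosets[OF yY] by (intro openin_continuous_map_preimage[OF continuous_map_product_projection]) auto
    moreover have "y \<in> ?W" using cosets[OF yY] by (auto simp: PiE_iff)
    moreover have "?W \<inter> odometer_space G \<Gamma> \<subseteq> U" using n by auto
    ultimately show "y \<in> ?V \<inter> odometer_space G \<Gamma>" using yY by blast
  qed auto
  ultimately show "?open U"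
    unfolding odometer_topology_def openin_subtopology by blast
qed

locale odometer_chain = group G for G (structure) +
  fixes \<Gamma> :: "nat \<Rightarrow> 'a set"
  assumes subgroup: "\<And>n. subgroup (\<Gamma> n) G"
    and finite_index: "\<And>n. finite (lcosets (\<Gamma> n))"
    and Suc_subset: "\<And>n. \<Gamma> (Suc n) \<subseteq> \<Gamma> n"
begin

abbreviation "Y \<equiv> odometer_space G \<Gamma>"
abbreviation "act \<equiv> odometer_action G \<Gamma>"

lemma \<Gamma>_carrier: "\<Gamma> n \<subseteq> carrier G"
  using subgroup by (rule subgroup.subset)

lemma \<Gamma>_mono: "m \<le> n \<Longrightarrow> \<Gamma> n \<subseteq> \<Gamma> m"
  using Suc_subset by (rule lift_Suc_antimono_le)

lemma \<Gamma>_absorb: "n \<le> m \<Longrightarrow> \<Gamma> m <#> \<Gamma> n = \<Gamma> n"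
  by (intro subgroup_mult_absorb subgroup \<Gamma>_mono subgroup.one_closed)

lemma lcosets_carrier: "C \<in> lcosets (\<Gamma> n) \<Longrightarrow> C \<subseteq> carrier G"
  using l_coset_subset_G[OF \<Gamma>_carrier] by (auto simp: LCOSETS_def)

text \<open>This identifies the projection between levels with a set product, so that no
  representatives have to be chosen.\<close>

lemma l_coset_proj: "g \<in> carrier G \<Longrightarrow> n \<le> m \<Longrightarrow> (g <# \<Gamma> m) <#> \<Gamma> n = g <# \<Gamma> n"
  by (simp add: setmult_lcos_assoc \<Gamma>_carrier \<Gamma>_absorb)

lemma proj_lcosets: "C \<in> lcosets (\<Gamma> m) \<Longrightarrow> n \<le> m \<Longrightarrow> C <#> \<Gamma> n \<in> lcosets (\<Gamma> n)"
  by (auto simp: LCOSETS_def l_coset_proj)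

lemma proj_proj: "C \<in> lcosets (\<Gamma> m) \<Longrightarrow> k \<le> n \<Longrightarrow> n \<le> m \<Longrightarrow> (C <#> \<Gamma> n) <#> \<Gamma> k = C <#> \<Gamma> k"
  by (auto simp: LCOSETS_def l_coset_proj)

lemma proj_equivariant:
  "C \<in> lcosets (\<Gamma> m) \<Longrightarrow> g \<in> carrier G \<Longrightarrow> (g <# C) <#> \<Gamma> n = g <# (C <#> \<Gamma> n)"
  by (simp add: setmult_lcos_assoc \<Gamma>_carrier lcosets_carrier)

lemma inj_on_l_coset: "g \<in> carrier G \<Longrightarrow> inj_on (\<lambda>C. g <# C) (lcosets (\<Gamma> n))"
  by (rule inj_on_inverseI[where g = "\<lambda>C. inv g <# C"])
    (simp add: lcos_m_assoc lcos_mult_one lcosets_carrier)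

text \<open>Eliminates the representatives from the definition: membership becomes a condition on
  the cosets alone, which is what measurability arguments can handle.\<close>

lemma odometer_space_iff:
  "y \<in> Y \<longleftrightarrow> (\<forall>n. y n \<in> lcosets (\<Gamma> n)) \<and> (\<forall>n. y (Suc n) <#> \<Gamma> n = y n)"
proof (intro iffI conjI allI; (elim conjE)?)
  assume "y \<in> Y"
  then obtain \<gamma> where \<gamma>: "y = (\<lambda>n. \<gamma> n <# \<Gamma> n)" "\<And>n. \<gamma> n \<in> carrier G"
    "\<And>n. \<gamma> n <# \<Gamma> n = \<gamma> (Suc n) <# \<Gamma> n"
    unfolding odometer_space_def by blast
  show "y n \<in> lcosets (\<Gamma> n)" "y (Suc n) <#> \<Gamma> n = y n" for n
    using \<gamma>(2) \<gamma>(3)[of n] by (auto simp: \<gamma>(1) l_coset_proj LCOSETS_def)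
next
  assume *: "\<forall>n. y n \<in> lcosets (\<Gamma> n)" "\<forall>n. y (Suc n) <#> \<Gamma> n = y n"
  then have "\<forall>n. \<exists>g\<in>carrier G. y n = g <# \<Gamma> n"
    by (auto simp: LCOSETS_def)
  then obtain \<gamma> where \<gamma>: "\<And>n. \<gamma> n \<in> carrier G" "\<And>n. y n = \<gamma> n <# \<Gamma> n"
    by metis
  have "\<gamma> n <# \<Gamma> n = \<gamma> (Suc n) <# \<Gamma> n" for n
    using *(2) \<gamma> l_coset_proj[OF \<gamma>(1)[of "Suc n"], of n "Suc n"] by simp
  then show "y \<in> Y"
    unfolding odometer_space_def using \<gamma> by blast
qed

text \<open>The sequence \<open>\<Gamma>\<close> itself is the base point, the coset of the identity
  at every level. It later serves as a default value.\<close>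

lemma \<Gamma>_in_odometer_space: "\<Gamma> \<in> Y"
  using lcos_mult_one[OF \<Gamma>_carrier] by (force simp: odometer_space_iff \<Gamma>_absorb LCOSETS_def)

lemma openin_odometer_iff:
  "openin (odometer_topology G \<Gamma>) U \<longleftrightarrow> U \<subseteq> Y \<and> (\<forall>y\<in>U. \<exists>n. \<forall>z\<in>Y. z n = y n \<longrightarrow> z \<in> U)"
  by (rule openin_odometer_topology_iff) (metis odometer_space_iff)+

lemma topspace_odometer: "topspace (odometer_topology G \<Gamma>) = Y"
  by (auto simp: odometer_topology_def odometer_space_iff PiE_iff)

lemma odometer_action_apply: "y \<in> Y \<Longrightarrow> act g y n = g <# y n"
  by (simp add: odometer_action_def)

lemma odometer_action_closed: "g \<in> carrier G \<Longrightarrow> y \<in> Y \<Longrightarrow> act g y \<in> Y"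
  using l_coset_mult_mem_lcosets[OF \<Gamma>_carrier] proj_equivariant[of "y (Suc n)" "Suc n" g n for n]
  by (subst odometer_space_iff) (simp add: odometer_action_apply odometer_space_iff)

lemma group_action_odometer: "group_action G Y act"
proof (rule group_actionI)
  have sub: "y n \<subseteq> carrier G" if "y \<in> Y" for y n
    using that lcosets_carrier by (auto simp: odometer_space_iff)
  show "act \<one> y = y" if "y \<in> Y" for y
    using that sub by (auto simp: odometer_action_apply lcos_mult_one)
  show "act (g \<otimes> h) y = act g (act h y)" if "g \<in> carrier G" "h \<in> carrier G" "y \<in> Y" for g h y
    using that sub odometer_action_closed by (auto simp: odometer_action_apply lcos_m_assoc)
  show "act g \<in> extensional Y" for g
    by (simp add: odometer_action_def)
qed (simp_all add: odometer_action_closed is_group)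

text \<open>Only the space and the sigma-algebra matter here; it is the target for
  \<open>measurable\<close> and \<open>distr\<close>.\<close>

definition borel_odometer :: "(nat \<Rightarrow> 'a set) measure" where
  "borel_odometer = sigma Y {U. openin (odometer_topology G \<Gamma>) U}"

lemma space_borel_odometer [simp]: "space borel_odometer = Y"
  using openin_subset topspace_odometer by (auto simp: borel_odometer_def intro!: space_measure_of)

lemma sets_borel_odometer: "sets borel_odometer = borel_sets (odometer_topology G \<Gamma>)"
  unfolding borel_odometer_def borel_sets_def topspace_odometer
  by (rule sets_measure_of) (use openin_subset topspace_odometer in blast)

lemma cylinder_in_borel: "{y \<in> Y. y n = c} \<in> sets borel_odometer"
  unfolding sets_borel_odometer borel_sets_def
  by (rule sigma_sets.Basic) (auto simp: openin_odometer_iff)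

lemma singleton_in_borel:
  assumes "y \<in> Y" shows "{y} \<in> sets borel_odometer"
proof -
  have "{y} = (\<Inter>n. {z \<in> Y. z n = y n})" using assms by auto
  also have "\<dots> \<in> sets borel_odometer" using cylinder_in_borel by (intro sets.countable_INT) auto
  finally show ?thesis .
qed

text \<open>Each level is finite, so there are only countably many cylinders, and every open set is
  the union of the cylinders that it contains. Hence cylinders suffice as test sets.\<close>

lemma measurable_into_borel_odometer:
  assumes f: "f \<in> space N \<rightarrow> Y"
    and cyl: "\<And>n c. c \<in> lcosets (\<Gamma> n) \<Longrightarrow> {x \<in> space N. f x n = c} \<in> sets N"
  shows "f \<in> measurable N borel_odometer"
  unfolding borel_odometer_def
proof (rule measurable_measure_of)
  show "{U. openin (odometer_topology G \<Gamma>) U} \<subseteq> Pow Y"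
    using openin_subset topspace_odometer by blast
  fix U assume "U \<in> {U. openin (odometer_topology G \<Gamma>) U}"
  then have U: "U \<subseteq> Y" "\<And>y. y \<in> U \<Longrightarrow> \<exists>n. \<forall>z\<in>Y. z n = y n \<longrightarrow> z \<in> U"
    by (auto simp: openin_odometer_iff)
  define I where "I = {(n, c). c \<in> lcosets (\<Gamma> n) \<and> {z \<in> Y. z n = c} \<subseteq> U}"
  have "I \<subseteq> Sigma UNIV (\<lambda>n. lcosets (\<Gamma> n))" by (auto simp: I_def)
  then have "countable I"
    by (rule countable_subset) (simp add: countable_finite finite_index)
  have "f -` U \<inter> space N = (\<Union>(n, c)\<in>I. {x \<in> space N. f x n = c})"
  proof (intro subset_antisym subsetI)
    fix x assume x: "x \<in> f -` U \<inter> space N"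
    then obtain n where "\<forall>z\<in>Y. z n = f x n \<longrightarrow> z \<in> U" using U(2) by blast
    then have "(n, f x n) \<in> I" using x U(1) by (auto simp: I_def odometer_space_iff)
    then show "x \<in> (\<Union>(n, c)\<in>I. {x \<in> space N. f x n = c})" using x by blast
  qed (use f in \<open>auto simp: I_def\<close>)
  also have "\<dots> \<in> sets N"
    using \<open>countable I\<close> cyl by (intro sets.countable_UN') (auto simp: I_def)
  finally show "f -` U \<inter> space N \<in> sets N" .
qed (fact f)

lemma odometer_action_measurable:
  assumes g: "g \<in> carrier G"
  shows "act g \<in> measurable borel_odometer borel_odometer"
proof (rule measurable_into_borel_odometer)
  show "act g \<in> space borel_odometer \<rightarrow> Y" using g by (simp add: odometer_action_closed)
  fix n c assume "c \<in> lcosets (\<Gamma> n)"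
  have "openin (odometer_topology G \<Gamma>) {y \<in> Y. act g y n = c}"
    unfolding openin_odometer_iff by (auto simp: odometer_action_apply intro!: exI[of _ n])
  then show "{y \<in> space borel_odometer. act g y n = c} \<in> sets borel_odometer"
    by (auto simp: sets_borel_odometer borel_sets_def)
qed

text \<open>At every level the finitely many cylinders partition an atom \<open>A\<close>, so one of
  them carries all of its mass. Intersecting these cylinders over all levels leaves a single
  sequence \<open>y\<close>, and \<open>A - {y}\<close> is null.\<close>

lemma atom_contains_point:
  assumes sets_\<nu>: "sets \<nu> = sets borel_odometer" and atomic: "\<not> nonatomic \<nu>"
  shows "\<exists>y\<in>Y. emeasure \<nu> {y} \<noteq> 0"
proof -
  obtain A where A: "A \<in> sets \<nu>" "emeasure \<nu> A \<noteq> 0"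
    and atom: "\<And>B. B \<in> sets \<nu> \<Longrightarrow> B \<subseteq> A \<Longrightarrow> emeasure \<nu> B = 0 \<or> emeasure \<nu> (A - B) = 0"
    using atomic by (auto simp: nonatomic_def)
  have A_Y: "A \<subseteq> Y"
    using sets.sets_into_space[OF A(1)] sets_eq_imp_space_eq[OF sets_\<nu>] by simp
  have cyl: "A \<inter> {y \<in> Y. y n = c} \<in> sets \<nu>" for n c
    using A(1) cylinder_in_borel by (simp add: sets_\<nu>)
  have "\<exists>c. emeasure \<nu> (A - {y \<in> Y. y n = c}) = 0" for n
  proof (rule ccontr)
    assume neg: "\<nexists>c. emeasure \<nu> (A - {y \<in> Y. y n = c}) = 0"
    have "A \<inter> {y \<in> Y. y n = c} \<in> null_sets \<nu>" for c
      using atom[OF cyl, of n c] neg cyl by (auto simp: null_sets_def Diff_Int)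
    then have "(\<Union>c\<in>lcosets (\<Gamma> n). A \<inter> {y \<in> Y. y n = c}) \<in> null_sets \<nu>"
      by (intro null_sets.finite_UN finite_index) auto
    moreover have "A = (\<Union>c\<in>lcosets (\<Gamma> n). A \<inter> {y \<in> Y. y n = c})"
      using A_Y by (auto simp: odometer_space_iff)
    ultimately show False using A(2) by (auto simp: null_sets_def)
  qed
  then obtain y where y: "\<forall>n. emeasure \<nu> (A - {z \<in> Y. z n = y n}) = 0"
    using choice[of "\<lambda>n c. emeasure \<nu> (A - {y \<in> Y. y n = c}) = 0"] by blast
  have "A - {z \<in> Y. z n = y n} \<in> null_sets \<nu>" for n
    using y A(1) cylinder_in_borel by (auto simp: null_sets_def sets_\<nu>)
  then have null: "(\<Union>n. A - {z \<in> Y. z n = y n}) \<in> null_sets \<nu>"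
    by (intro null_sets_UN)
  have sub: "A - {y} \<subseteq> (\<Union>n. A - {z \<in> Y. z n = y n})"
    by auto
  have "A \<notin> null_sets \<nu>" using A(2) by auto
  then have no_cover: "\<not> A \<subseteq> N" if "N \<in> null_sets \<nu>" for N
    using null_sets_subset[OF that A(1)] by blast
  show ?thesis
  proof (rule bexI[of _ y])
    \<comment> \<open>The coordinates of \<open>y\<close> were chosen level by level, so
      compatibility is not automatic. If it failed, \<open>y\<close> would lie outside
      \<open>A\<close>, and all of \<open>A\<close> would be covered by the null set.\<close>
    show "y \<in> Y"
    proof (rule ccontr)
      assume "y \<notin> Y"
      then have "A \<subseteq> (\<Union>n. A - {z \<in> Y. z n = y n})" using A_Y sub by blast
      then show False using no_cover[OF null] by blast
    qed
    then have sing: "{y} \<in> sets \<nu>" by (simp add: sets_\<nu> singleton_in_borel)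
    show "emeasure \<nu> {y} \<noteq> 0"
    proof
      assume "emeasure \<nu> {y} = 0"
      then have "{y} \<union> (\<Union>n. A - {z \<in> Y. z n = y n}) \<in> null_sets \<nu>"
        using sing null by (intro null_sets.Un) (auto simp: null_sets_def)
      moreover have "A \<subseteq> {y} \<union> (\<Union>n. A - {z \<in> Y. z n = y n})" using sub by blast
      ultimately show False using no_cover by blast
    qed
  qed
qed

end

section \<open>Stabilizers of atoms of an equivariant image\<close>

text \<open>Split a non-null set repeatedly into two non-null pieces; by additivity one piece has at
  most half of the value of \<open>f\<close>. Here \<open>f\<close> may differ from the measure of
  \<open>M\<close>: it will be a sum of measures of translates.\<close>

lemma nonatomic_small_subset:
  fixes f :: "'x set \<Rightarrow> real"
  assumes M: "nonatomic M"
    and f_add: "\<And>A B. A \<in> sets M \<Longrightarrow> B \<in> sets M \<Longrightarrow> A \<inter> B = {} \<Longrightarrow> f (A \<union> B) = f A + f B"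
    and Z: "Z \<in> sets M" "emeasure M Z \<noteq> 0"
    and e: "0 < e"
  shows "\<exists>B\<in>sets M. B \<subseteq> Z \<and> emeasure M B \<noteq> 0 \<and> f B < e"
proof -
  have halves: "\<exists>B\<in>sets M. B \<subseteq> Z \<and> emeasure M B \<noteq> 0 \<and> f B \<le> f Z / 2 ^ n" for n
  proof (induction n)
    case 0
    then show ?case using Z by auto
  next
    case (Suc n)
    then obtain A where A: "A \<in> sets M" "A \<subseteq> Z" "emeasure M A \<noteq> 0" "f A \<le> f Z / 2 ^ n" by blast
    then have "0 < emeasure M A" by (simp add: zero_less_iff_neq_zero)
    then obtain B where B: "B \<in> sets M" "B \<subseteq> A" "emeasure M B \<noteq> 0" "emeasure M (A - B) \<noteq> 0"
      using M A(1) unfolding nonatomic_def by blast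
    have "f A = f B + f (A - B)"
      using f_add[of B "A - B"] A B by (simp add: Un_absorb1)
    moreover have "f A / 2 \<le> f Z / 2 ^ Suc n"
      using divide_right_mono[OF A(4), of 2] by simp
    ultimately have "f B \<le> f Z / 2 ^ Suc n \<or> f (A - B) \<le> f Z / 2 ^ Suc n" by linarith
    then show ?case
    proof
      assume "f B \<le> f Z / 2 ^ Suc n"
      then show ?thesis using A B by blast
    next
      assume "f (A - B) \<le> f Z / 2 ^ Suc n"
      then show ?thesis using A B by (intro bexI[of _ "A - B"]) auto
    qed
  qed
  obtain n where n: "f Z / e < 2 ^ n"
    using real_arch_pow[of 2 "f Z / e"] by auto
  then have "f Z / 2 ^ n < e"
    using e by (simp add: field_simps)
  moreover obtain B where "B \<in> sets M" "B \<subseteq> Z" "emeasure M B \<noteq> 0" "f B \<le> f Z / 2 ^ n"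
    using halves[of n] by blast
  ultimately show ?thesis
    by (intro bexI[of _ B]) simp_all
qed

context ergodic_nonsingular_action
begin

context
  fixes N :: "'y measure" and S :: "'a \<Rightarrow> 'y \<Rightarrow> 'y" and \<phi> :: "'x \<Rightarrow> 'y" and y :: 'y
  assumes S: "group_action G (space N) S"
    and \<phi>[measurable]: "\<phi> \<in> measurable M N"
    and equivariant: "\<And>g. g \<in> carrier G \<Longrightarrow> AE x in M. \<phi> (T g x) = S g (\<phi> x)"
    and singleton: "\<And>z. z \<in> space N \<Longrightarrow> {z} \<in> sets N"
    and y: "y \<in> space N"
    and fibre: "emeasure M (\<phi> -` {y} \<inter> space M) \<noteq> 0"
begin

interpretation S: group_action G "space N" S by (fact S)

text \<open>The orbit-stabilizer correspondence: the elements carrying \<open>y\<close> to a given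
  point of its orbit form one left coset of the stabilizer.\<close>

lemma S_eq_coset:
  assumes k: "k \<in> carrier G"
  shows "{g \<in> carrier G. S g y = S k y} = k <# stabilizer G S y"
proof (intro subset_antisym subsetI)
  fix g assume "g \<in> {g \<in> carrier G. S g y = S k y}"
  then have g: "g \<in> carrier G" and gk: "S g y = S k y" by blast+
  have "S (inv k \<otimes> g) y = S (inv k) (S g y)"
    by (rule S.composition_rule) (use g k y in simp_all)
  also have "\<dots> = y"
    using k y gk[symmetric] by (rule S.orbit_sym_aux)
  finally have "inv k \<otimes> g \<in> stabilizer G S y"
    using g k by (simp add: stabilizer_def)
  moreover have "g = k \<otimes> (inv k \<otimes> g)"
    using g k by (metis inv_closed l_one m_assoc r_inv)
  ultimately show "g \<in> k <# stabilizer G S y"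
    unfolding l_coset_def by blast
next
  fix g assume "g \<in> k <# stabilizer G S y"
  then obtain h where h: "h \<in> carrier G" "S h y = y" "g = k \<otimes> h"
    unfolding l_coset_def stabilizer_def by blast
  then show "g \<in> {g \<in> carrier G. S g y = S k y}"
    using k y by (simp add: S.composition_rule)
qed

text \<open>The orbit of \<open>y\<close> is countable and invariant, and its preimage contains the
  non-null fibre over \<open>y\<close>, so by ergodicity \<open>\<phi>\<close> takes almost all its
  values in this orbit. The orbit is then identified with the cosets of the stabilizer.\<close>

lemma homogeneous_factor_of_atom: "has_homogeneous_factor G M T (stabilizer G S y)"
proof -
  let ?H = "stabilizer G S y"
  have H: "?H \<subseteq> carrier G" by (auto simp: stabilizer_def)
  define Orb where "Orb = (\<lambda>g. S g y) ` carrier G"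
  have Orb_sub: "Orb \<subseteq> space N"
    unfolding Orb_def using S.element_image[OF _ y refl] by blast
  have countable_Orb: "countable Orb"
    using countable_group by (simp add: Orb_def)
  have sets_countable: "A \<in> sets N" if "A \<subseteq> Orb" for A
  proof (rule sets.countable)
    show "{z} \<in> sets N" if "z \<in> A" for z
      using that \<open>A \<subseteq> Orb\<close> Orb_sub by (intro singleton) blast
    show "countable A"
      using that countable_Orb by (rule countable_subset)
  qed
  have y_Orb: "y \<in> Orb"
    unfolding Orb_def by (rule image_eqI[of _ _ \<one>]) (simp_all add: S.one_action y)
  \<comment> \<open>On the orbit, \<open>p\<close> sends a point to the coset of elements carrying
    \<open>y\<close> to it. Off the orbit the trivial coset is a default that keeps the values in
    the coset space.\<close>
  define p where "p z = (if z \<in> Orb then {g \<in> carrier G. S g y = z} else ?H)" for z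
  have p_Orb: "p (S k y) = k <# ?H" if "k \<in> carrier G" for k
  proof -
    have "S k y \<in> Orb" using that by (simp add: Orb_def)
    then show ?thesis using S_eq_coset[OF that] by (simp only: p_def if_True)
  qed
  have H_coset: "?H \<in> lcosets ?H"
    unfolding LCOSETS_def using lcos_mult_one[OF H] one_closed by blast
  have p[measurable]: "p \<in> measurable N (count_space (lcosets ?H))"
  proof (rule measurableI)
    show "p z \<in> space (count_space (lcosets ?H))" for z
    proof (cases "z \<in> Orb")
      case True
      then obtain k where "k \<in> carrier G" "z = S k y" unfolding Orb_def by blast
      then show ?thesis by (simp add: p_Orb) (auto simp: LCOSETS_def)
    next
      case False
      then show ?thesis using H_coset by (simp add: p_def)
    qed
    fix A
    \<comment> \<open>Inside the orbit every subset is countable, hence measurable; outside it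
      \<open>p\<close> is constant.\<close>
    have "p -` A \<inter> space N = (p -` A \<inter> Orb) \<union> (if ?H \<in> A then space N - Orb else {})"
      using Orb_sub by (auto simp: p_def split: if_splits)
    also have "\<dots> \<in> sets N"
      using sets_countable[of "p -` A \<inter> Orb"] sets_countable[of Orb] by (simp add: sets.Diff)
    finally show "p -` A \<inter> space N \<in> sets N" .
  qed
  have S_Orb_iff: "S g z \<in> Orb \<longleftrightarrow> z \<in> Orb" if g: "g \<in> carrier G" and z: "z \<in> space N" for g z
  proof
    assume "S g z \<in> Orb"
    then obtain k where k: "k \<in> carrier G" "S g z = S k y" unfolding Orb_def by blast
    have "S (inv g \<otimes> k) y = z"
      using S.orbit_sym_aux[OF g z k(2)] g k y by (simp add: S.composition_rule)
    then show "z \<in> Orb" unfolding Orb_def using g k by blast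
  next
    assume "z \<in> Orb"
    then obtain k where k: "k \<in> carrier G" "z = S k y" unfolding Orb_def by blast
    then have "S g z = S (g \<otimes> k) y"
      using g y by (simp add: S.composition_rule)
    then show "S g z \<in> Orb" unfolding Orb_def using g k by blast
  qed
  have "(AE x in M. x \<in> \<phi> -` Orb \<inter> space M) \<or> (AE x in M. x \<notin> \<phi> -` Orb \<inter> space M)"
  proof (rule AE_in_or_notin)
    show "\<phi> -` Orb \<inter> space M \<in> sets M"
      using sets_countable by (intro measurable_sets[OF \<phi>]) simp
    fix g assume g: "g \<in> carrier G"
    show "AE x in M. T g x \<in> \<phi> -` Orb \<inter> space M \<longleftrightarrow> x \<in> \<phi> -` Orb \<inter> space M"
      using equivariant[OF g] AE_space
      by eventually_elim (use T_space[OF g] S_Orb_iff[OF g] measurable_space[OF \<phi>] in auto)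
  qed
  moreover have "\<not> (AE x in M. x \<notin> \<phi> -` Orb \<inter> space M)"
  proof
    assume "AE x in M. x \<notin> \<phi> -` Orb \<inter> space M"
    then have "AE x in M. x \<notin> \<phi> -` {y} \<inter> space M"
      by eventually_elim (use y_Orb in auto)
    moreover have "\<phi> -` {y} \<inter> space M \<in> sets M"
      using \<phi> singleton[OF y] by (rule measurable_sets)
    ultimately have "\<phi> -` {y} \<inter> space M \<in> null_sets M"
      by (simp add: AE_iff_null_sets)
    then show False
      using fibre by (simp add: null_sets_def)
  qed
  ultimately have "AE x in M. x \<in> \<phi> -` Orb \<inter> space M"
    by blast
  then have AE_Orb: "AE x in M. \<phi> x \<in> Orb"
    by eventually_elim simp
  have "is_factor G M T (distr M (count_space (lcosets ?H)) (p \<circ> \<phi>)) (coset_action G ?H)"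
  proof (rule image_measure_factor(1))
    show "group_action G (space (count_space (lcosets ?H))) (coset_action G ?H)"
      using group_action_coset_action[OF H] by simp
    show "coset_action G ?H g \<in> measurable (count_space (lcosets ?H)) (count_space (lcosets ?H))"
      if "g \<in> carrier G" for g
      using that l_coset_mult_mem_lcosets[OF H] by (simp add: coset_action_def)
    show "p \<circ> \<phi> \<in> measurable M (count_space (lcosets ?H))"
      using \<phi> p by (rule measurable_comp)
    fix h assume h: "h \<in> carrier G"
    show "AE x in M. (p \<circ> \<phi>) (T h x) = coset_action G ?H h ((p \<circ> \<phi>) x)"
      using equivariant[OF h] AE_Orb
    proof eventually_elim
      fix x assume eq: "\<phi> (T h x) = S h (\<phi> x)" and "\<phi> x \<in> Orb"
      then obtain k where k: "k \<in> carrier G" "\<phi> x = S k y" unfolding Orb_def by blast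
      have "\<phi> (T h x) = S (h \<otimes> k) y"
        using eq h k y by (simp add: S.composition_rule)
      then have "p (\<phi> (T h x)) = h <# (k <# ?H)"
        using h k H by (simp add: p_Orb lcos_m_assoc)
      then show "(p \<circ> \<phi>) (T h x) = coset_action G ?H h ((p \<circ> \<phi>) x)"
        using k l_coset_mult_mem_lcosets[OF H H_coset k(1)] lcos_mult_one[OF H]
        by (simp add: p_Orb coset_action_def)
    qed
  qed
  then show ?thesis
    unfolding has_homogeneous_factor_def by (intro exI[of _ "distr M (count_space (lcosets ?H)) (p \<circ> \<phi>)"]) simp
qed

text \<open>If the stabilizer were finite, the fibre \<open>Z\<close> over \<open>y\<close> would
  contain a non-null \<open>B\<close> whose preimages under the stabilizer have total measure below
  that of \<open>Z\<close>. By ergodicity almost every point of \<open>Z\<close> is moved into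
  \<open>B\<close> by some \<open>g\<close>. Since \<open>B\<close> also lies over \<open>y\<close>,
  such a \<open>g\<close> fixes \<open>y\<close>, so these few preimages would cover almost all of
  \<open>Z\<close>.\<close>

lemma infinite_stabilizer_of_atom:
  assumes M: "nonatomic M"
  shows "infinite (stabilizer G S y)"
proof
  let ?H = "stabilizer G S y"
  assume fin: "finite ?H"
  have H: "?H \<subseteq> carrier G" by (auto simp: stabilizer_def)
  define Z where "Z = \<phi> -` {y} \<inter> space M"
  have Z: "Z \<in> sets M" "emeasure M Z \<noteq> 0"
    using fibre measurable_sets[OF \<phi> singleton[OF y]] by (auto simp: Z_def)
  have vimage_sets: "T g -` B \<inter> space M \<in> sets M" if "g \<in> carrier G" "B \<in> sets M" for g B
    using measurable_sets[OF T_measurable] that by blast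
  define f where "f B = (\<Sum>s\<in>?H. measure M (T s -` B \<inter> space M))" for B
  have f_add: "f (A \<union> B) = f A + f B" if "A \<in> sets M" "B \<in> sets M" "A \<inter> B = {}" for A B
    unfolding f_def sum.distrib[symmetric]
  proof (rule sum.cong[OF refl])
    fix s assume "s \<in> ?H"
    then have "s \<in> carrier G" using H by blast
    then show "measure M (T s -` (A \<union> B) \<inter> space M) = measure M (T s -` A \<inter> space M) + measure M (T s -` B \<inter> space M)"
      using that vimage_sets by (subst M.finite_measure_Union[symmetric]) (auto simp: vimage_Un Int_Un_distrib2)
  qed
  obtain B where B: "B \<in> sets M" "B \<subseteq> Z" "emeasure M B \<noteq> 0" "f B < measure M Z"
  proof -
    have "0 < measure M Z"
      using Z(2) by (simp add: M.emeasure_eq_measure zero_less_measure_iff)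
    then show thesis
      using nonatomic_small_subset[OF M f_add Z] that by blast
  qed
  \<comment> \<open>The saturation of \<open>B\<close> under the group: it is invariant and contains
    the non-null \<open>B\<close>, hence is conull.\<close>
  define W where "W = (\<Union>g\<in>carrier G. T g -` B \<inter> space M)"
  have W: "W \<in> sets M"
    unfolding W_def using countable_group vimage_sets B(1) by (intro sets.countable_UN') auto
  have W_iff: "x \<in> W \<longleftrightarrow> x \<in> space M \<and> (\<exists>g\<in>carrier G. T g x \<in> B)" for x
    by (auto simp: W_def)
  have "T h x \<in> W \<longleftrightarrow> x \<in> W" if h: "h \<in> carrier G" and x: "x \<in> space M" for h x
  proof
    assume "T h x \<in> W"
    then obtain g where "g \<in> carrier G" "T g (T h x) \<in> B" by (auto simp: W_iff)
    then have "T (g \<otimes> h) x \<in> B" using h x by (simp add: T.composition_rule)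
    then show "x \<in> W" using h x \<open>g \<in> carrier G\<close> by (auto simp: W_iff)
  next
    assume "x \<in> W"
    then obtain g where g: "g \<in> carrier G" "T g x \<in> B" by (auto simp: W_iff)
    have "T (g \<otimes> inv h) (T h x) = T g x"
      using g h x by (simp add: m_assoc flip: T.composition_rule)
    then have "T (g \<otimes> inv h) (T h x) \<in> B" using g by simp
    then show "T h x \<in> W" using g h x T_space[OF h x] by (auto simp: W_iff)
  qed
  then have "(AE x in M. x \<in> W) \<or> (AE x in M. x \<notin> W)"
    by (intro AE_in_or_notin W AE_I2) auto
  moreover have "\<not> (AE x in M. x \<notin> W)"
  proof
    assume "AE x in M. x \<notin> W"
    then have "AE x in M. x \<notin> B"
      using AE_space
    proof eventually_elim
      fix x assume "x \<notin> W" "x \<in> space M"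
      moreover have "T \<one> x = x"
        using \<open>x \<in> space M\<close> by (rule T.one_action)
      ultimately show "x \<notin> B" by (metis W_iff one_closed)
    qed
    then show False
      using B by (subst (asm) AE_iff_null_sets[symmetric]) auto
  qed
  ultimately have AE_W: "AE x in M. x \<in> W" by blast
  \<comment> \<open>The element moving \<open>x\<close> into \<open>B\<close> depends on
    \<open>x\<close>, so equivariance is needed for all group elements on one conull set;
    countability provides it.\<close>
  have "AE x in M. \<forall>g\<in>carrier G. \<phi> (T g x) = S g (\<phi> x)"
    using countable_group equivariant by (simp add: AE_ball_countable)
  with AE_W have "AE x in M. x \<in> Z \<longrightarrow> x \<in> (\<Union>s\<in>?H. T s -` B \<inter> space M)"
  proof eventually_elim
    fix x assume x: "x \<in> W" "\<forall>g\<in>carrier G. \<phi> (T g x) = S g (\<phi> x)"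
    show "x \<in> Z \<longrightarrow> x \<in> (\<Union>s\<in>?H. T s -` B \<inter> space M)"
    proof
      assume "x \<in> Z"
      obtain g where g: "g \<in> carrier G" "T g x \<in> B" using x(1) by (auto simp: W_iff)
      have "S g y = y"
        using x(2) g B(2) \<open>x \<in> Z\<close> by (auto simp: Z_def)
      then have "g \<in> ?H" using g(1) by (simp add: stabilizer_def)
      then show "x \<in> (\<Union>s\<in>?H. T s -` B \<inter> space M)"
        using g \<open>x \<in> Z\<close> by (auto simp: Z_def)
    qed
  qed
  then have "measure M Z \<le> measure M (\<Union>s\<in>?H. T s -` B \<inter> space M)"
    using fin H vimage_sets[OF _ B(1)] by (intro M.finite_measure_mono_AE sets.finite_UN) auto
  also have "\<dots> \<le> f B"
    unfolding f_def using fin H vimage_sets[OF _ B(1)] by (intro M.finite_measure_subadditive_finite) auto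
  finally show False using B(4) by simp
qed

end

end

section \<open>Gluing the finite factors into a map to the odometer\<close>

locale odometer_factors = ergodic_nonsingular_action G M T + odometer_chain G \<Gamma>
  for G (structure) and M :: "'x measure" and T :: "'a \<Rightarrow> 'x \<Rightarrow> 'x" and \<Gamma> +
  assumes homogeneous: "\<And>n. has_homogeneous_factor G M T (\<Gamma> n)"
begin

text \<open>Keeps only the map from a finite factor and forgets its measure. Plain
  \<open>g <# \<phi> x\<close> replaces \<open>coset_action\<close>, with which it agrees on
  cosets.\<close>

definition level_map :: "nat \<Rightarrow> ('x \<Rightarrow> 'a set) \<Rightarrow> bool" where
  "level_map n \<phi> \<longleftrightarrow> \<phi> \<in> measurable M (count_space (lcosets (\<Gamma> n))) \<and>
     (\<forall>g\<in>carrier G. AE x in M. \<phi> (T g x) = g <# \<phi> x)"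

lemma level_map_in_lcosets: "level_map n \<phi> \<Longrightarrow> x \<in> space M \<Longrightarrow> \<phi> x \<in> lcosets (\<Gamma> n)"
  unfolding level_map_def using measurable_space[of \<phi> M "count_space (lcosets (\<Gamma> n))" x] by simp

lemma ex_level_map: "\<exists>\<phi>. level_map n \<phi>"
proof -
  obtain \<kappa> \<phi> where \<kappa>: "sets \<kappa> = Pow (lcosets (\<Gamma> n))" and \<phi>: "\<phi> \<in> measurable M \<kappa>"
    and eq: "\<And>g. g \<in> carrier G \<Longrightarrow> AE x in M. \<phi> (T g x) = coset_action G (\<Gamma> n) g (\<phi> x)"
    using homogeneous[of n] unfolding has_homogeneous_factor_def is_factor_def by blast
  have \<phi>': "\<phi> \<in> measurable M (count_space (lcosets (\<Gamma> n)))"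
    using \<phi> measurable_cong_sets[of M M \<kappa> "count_space (lcosets (\<Gamma> n))"] by (simp add: \<kappa>)
  have "AE x in M. \<phi> (T g x) = g <# \<phi> x" if "g \<in> carrier G" for g
    using eq[OF that] AE_space
    by eventually_elim (use measurable_space[OF \<phi>'] in \<open>auto simp: coset_action_def\<close>)
  then have "level_map n \<phi>"
    using \<phi>' by (simp add: level_map_def)
  then show ?thesis by (rule exI[of "level_map n" \<phi>])
qed

lemma level_map_proj:
  assumes \<phi>: "level_map m \<phi>" and "n \<le> m"
  shows "level_map n (\<lambda>x. \<phi> x <#> \<Gamma> n)"
  unfolding level_map_def
proof (intro conjI ballI)
  have "(\<lambda>C. C <#> \<Gamma> n) \<in> measurable (count_space (lcosets (\<Gamma> m))) (count_space (lcosets (\<Gamma> n)))"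
    using proj_lcosets \<open>n \<le> m\<close> by auto
  moreover have "\<phi> \<in> measurable M (count_space (lcosets (\<Gamma> m)))"
    using \<phi> by (simp add: level_map_def)
  ultimately show "(\<lambda>x. \<phi> x <#> \<Gamma> n) \<in> measurable M (count_space (lcosets (\<Gamma> n)))"
    by (rule measurable_compose[rotated])
  fix g assume g: "g \<in> carrier G"
  then have "AE x in M. \<phi> (T g x) = g <# \<phi> x"
    using \<phi> by (auto simp: level_map_def)
  then show "AE x in M. \<phi> (T g x) <#> \<Gamma> n = g <# (\<phi> x <#> \<Gamma> n)"
    using AE_space by eventually_elim (use level_map_in_lcosets[OF \<phi>] g in \<open>simp add: proj_equivariant[of _ m]\<close>)
qed

lemma level_maps_agree_or_differ:
  assumes "level_map n \<phi>" "level_map n \<psi>"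
  shows "(AE x in M. \<phi> x = \<psi> x) \<or> (AE x in M. \<phi> x \<noteq> \<psi> x)"
proof (rule equivariant_maps_agree_or_differ[where S = "l_coset G" and C = "lcosets (\<Gamma> n)"])
  show "inj_on (\<lambda>C. g <# C) (lcosets (\<Gamma> n))" if "g \<in> carrier G" for g
    using that by (rule inj_on_l_coset)
  show "countable (lcosets (\<Gamma> n))"
    by (rule countable_finite[OF finite_index])
qed (use assms in \<open>simp_all add: level_map_def\<close>)

text \<open>Two level maps that agree at a generic point \<open>x0\<close> agree almost everywhere, so Koenig's lemma
  for the values at \<open>x0\<close> selects level maps that are compatible almost everywhere.\<close>

lemma compatible_level_maps:
  "\<exists>\<psi>. \<forall>n. level_map n (\<psi> n) \<and> (AE x in M. \<psi> (Suc n) x <#> \<Gamma> n = \<psi> n x)"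
proof -
  obtain \<phi> where \<phi>: "\<And>n. level_map n (\<phi> n)"
    using choice[of level_map] ex_level_map by blast
  \<comment> \<open>\<open>\<Phi> m n\<close> is the map into level \<open>n\<close> induced from
    level \<open>m\<close>. For fixed \<open>m\<close> these are compatible at the levels up to
    \<open>m\<close>, and a limit in \<open>m\<close> has to be taken.\<close>
  define \<Phi> where "\<Phi> m n x = \<phi> m x <#> \<Gamma> n" for m n x
  have \<Phi>: "level_map n (\<Phi> m n)" if "n \<le> m" for m n
    using level_map_proj[OF \<phi> that] unfolding \<Phi>_def[abs_def] .
  have \<Phi>_proj: "\<Phi> m (Suc n) x <#> \<Gamma> n = \<Phi> m n x" if "Suc n \<le> m" "x \<in> space M" for m n x
    using that level_map_in_lcosets[OF \<phi>] by (simp add: \<Phi>_def proj_proj[of _ m])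
  \<comment> \<open>For each of the countably many triples, either the two maps agree a.e. and the
    conclusion is true, or they differ a.e. and the premise fails a.e. The nested quantifier does
    not depend on \<open>x\<close>, so any point of this conull set can serve as
    \<open>x0\<close>.\<close>
  have "AE x in M. \<forall>m m' n. n \<le> m \<and> n \<le> m' \<and> \<Phi> m n x = \<Phi> m' n x \<longrightarrow> (AE x in M. \<Phi> m n x = \<Phi> m' n x)"
    unfolding AE_all_countable
  proof (intro allI)
    fix m m' n
    show "AE x in M. n \<le> m \<and> n \<le> m' \<and> \<Phi> m n x = \<Phi> m' n x \<longrightarrow> (AE x in M. \<Phi> m n x = \<Phi> m' n x)"
    proof (cases "n \<le> m \<and> n \<le> m'")
      case True
      then consider "AE x in M. \<Phi> m n x = \<Phi> m' n x" | "AE x in M. \<Phi> m n x \<noteq> \<Phi> m' n x"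
        using level_maps_agree_or_differ[OF \<Phi> \<Phi>, of n m m'] by blast
      then show ?thesis
      proof cases
        case 2
        then show ?thesis by eventually_elim simp
      qed simp
    qed auto
  qed
  then have "AE x in M. x \<in> space M \<and> (\<forall>m m' n. n \<le> m \<and> n \<le> m' \<and> \<Phi> m n x = \<Phi> m' n x \<longrightarrow> (AE x in M. \<Phi> m n x = \<Phi> m' n x))"
    using AE_space by (rule eventually_elim2) simp
  from eventually_happens'[OF M.ae_filter_bot this]
  obtain x0 where x0: "x0 \<in> space M"
    and generic: "\<And>m m' n. n \<le> m \<Longrightarrow> n \<le> m' \<Longrightarrow> \<Phi> m n x0 = \<Phi> m' n x0 \<Longrightarrow> AE x in M. \<Phi> m n x = \<Phi> m' n x"
    by (elim exE conjE) simp
  have finite_range: "finite ((\<lambda>m. \<Phi> m n x0) ` A)" if "\<And>m. m \<in> A \<Longrightarrow> n \<le> m" for n A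
    using level_map_in_lcosets[OF \<Phi> x0] that
    by (intro finite_subset[OF _ finite_index[of n]]) auto
  \<comment> \<open>The invariant of the choice is that infinitely many \<open>m\<close> induce the
    value \<open>y n\<close> at \<open>x0\<close>; finiteness of the next level lets the pigeonhole
    principle refine it.\<close>
  have "\<exists>y. \<forall>n. infinite {m. n \<le> m \<and> \<Phi> m n x0 = y n} \<and> y (Suc n) <#> \<Gamma> n = y n"
  proof (rule dependent_nat_choice)
    show "\<exists>c. infinite {m. 0 \<le> m \<and> \<Phi> m 0 x0 = c}"
      using pigeonhole_infinite[OF infinite_UNIV_nat finite_range[of UNIV 0]] by auto
    fix c n assume inf: "infinite {m. n \<le> m \<and> \<Phi> m n x0 = c}"
    \<comment> \<open>Removing \<open>n\<close> leaves only indices \<open>m\<close> for which level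
      \<open>Suc n\<close> is still a projection of level \<open>m\<close>.\<close>
    define A where "A = {m. n \<le> m \<and> \<Phi> m n x0 = c} - {n}"
    have A: "infinite A" "\<And>m. m \<in> A \<Longrightarrow> Suc n \<le> m"
      using inf by (auto simp: A_def)
    obtain m0 where m0: "m0 \<in> A" "infinite {m \<in> A. \<Phi> m (Suc n) x0 = \<Phi> m0 (Suc n) x0}"
      using pigeonhole_infinite[OF A(1) finite_range[of A "Suc n"]] A(2) by auto
    have "infinite {m. Suc n \<le> m \<and> \<Phi> m (Suc n) x0 = \<Phi> m0 (Suc n) x0}"
      using A(2) by (intro infinite_super[OF _ m0(2)]) auto
    moreover have "\<Phi> m0 (Suc n) x0 <#> \<Gamma> n = c"
      using \<Phi>_proj[OF A(2)[OF m0(1)] x0] m0(1) by (auto simp: A_def)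
    ultimately show "\<exists>c'. infinite {m. Suc n \<le> m \<and> \<Phi> m (Suc n) x0 = c'} \<and> c' <#> \<Gamma> n = c"
      by blast
  qed
  then obtain y where y: "\<And>n. infinite {m. n \<le> m \<and> \<Phi> m n x0 = y n}" "\<And>n. y (Suc n) <#> \<Gamma> n = y n"
    by blast
  have "\<exists>m. n \<le> m \<and> \<Phi> m n x0 = y n" for n
    using not_finite_existsD[OF y(1)] by blast
  then obtain m where m: "\<And>n. n \<le> m n" "\<And>n. \<Phi> (m n) n x0 = y n"
    by metis
  show ?thesis
  proof (intro exI[of _ "\<lambda>n. \<Phi> (m n) n"] allI conjI)
    fix n
    show "level_map n (\<Phi> (m n) n)"
      by (rule \<Phi>[OF m(1)])
    \<comment> \<open>Different source levels may be used for \<open>n\<close> and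
      \<open>Suc n\<close>. Their maps into level \<open>n\<close> agree at \<open>x0\<close>, since
      \<open>y\<close> is compatible, and genericity upgrades this to a.e. agreement.\<close>
    have "\<Phi> (m (Suc n)) n x0 = \<Phi> (m n) n x0"
      using \<Phi>_proj[OF m(1) x0] m(2) y(2) by metis
    then have "AE x in M. \<Phi> (m (Suc n)) n x = \<Phi> (m n) n x"
      using m(1)[of n] Suc_leD[OF m(1)] by (intro generic) auto
    then show "AE x in M. \<Phi> (m (Suc n)) (Suc n) x <#> \<Gamma> n = \<Phi> (m n) n x"
      using AE_space by eventually_elim (use \<Phi>_proj[OF m(1)] in simp)
  qed
qed

text \<open>The level maps are the coordinates. They form a point of the odometer only off a null
  set, where the sequence has to be replaced by a fixed point.\<close>

lemma ex_odometer_map: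
  "\<exists>\<phi>\<in>measurable M borel_odometer. \<forall>g\<in>carrier G. AE x in M. \<phi> (T g x) = act g (\<phi> x)"
proof -
  obtain \<psi> where \<psi>: "\<And>n. level_map n (\<psi> n)" "\<And>n. AE x in M. \<psi> (Suc n) x <#> \<Gamma> n = \<psi> n x"
    using compatible_level_maps by blast
  have \<psi>_meas: "\<psi> n -` A \<inter> space M \<in> sets M" if "A \<subseteq> lcosets (\<Gamma> n)" for n A
    using \<psi>(1)[of n] that by (auto simp: level_map_def intro!: measurable_sets)
  define E where "E = {x \<in> space M. (\<lambda>n. \<psi> n x) \<in> Y}"
  have "AE x in M. \<forall>n. \<psi> (Suc n) x <#> \<Gamma> n = \<psi> n x"
    using \<psi>(2) by (simp add: AE_all_countable)
  then have AE_E: "AE x in M. x \<in> E"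
    using AE_space by eventually_elim (auto simp: E_def odometer_space_iff level_map_in_lcosets[OF \<psi>(1)])
  have E: "E \<in> sets M"
  proof -
    \<comment> \<open>Compatibility at level \<open>n\<close> is checked separately for each of the
      finitely many values \<open>c\<close> at level \<open>Suc n\<close>.\<close>
    have "E = (\<Inter>n. \<Union>c\<in>lcosets (\<Gamma> (Suc n)).
        (\<psi> (Suc n) -` {c} \<inter> space M) \<inter> (\<psi> n -` {c <#> \<Gamma> n} \<inter> space M))"
      using level_map_in_lcosets[OF \<psi>(1)] by (auto simp: E_def odometer_space_iff)
    also have "\<dots> \<in> sets M"
      using finite_index by (intro sets.countable_INT sets.finite_UN image_subsetI sets.Int \<psi>_meas) (auto simp: proj_lcosets)
    finally show ?thesis .
  qed
  \<comment> \<open>The base point \<open>\<Gamma>\<close> as default makes \<open>\<phi>\<close>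
    take values in the odometer everywhere.\<close>
  define \<phi> where "\<phi> x = (if x \<in> E then (\<lambda>n. \<psi> n x) else \<Gamma>)" for x
  show ?thesis
  proof (intro bexI[of _ \<phi>] ballI)
    show "\<phi> \<in> measurable M borel_odometer"
    proof (rule measurable_into_borel_odometer)
      show "\<phi> \<in> space M \<rightarrow> Y"
        by (auto simp: \<phi>_def E_def \<Gamma>_in_odometer_space)
      fix n c assume "c \<in> lcosets (\<Gamma> n)"
      have "{x \<in> space M. \<phi> x n = c} = (\<psi> n -` {c} \<inter> space M \<inter> E) \<union> (if \<Gamma> n = c then space M - E else {})"
        by (auto simp: \<phi>_def)
      also have "\<dots> \<in> sets M"
        using E \<psi>_meas[of "{c}" n] \<open>c \<in> lcosets (\<Gamma> n)\<close> by auto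
      finally show "{x \<in> space M. \<phi> x n = c} \<in> sets M" .
    qed
    fix g assume g: "g \<in> carrier G"
    have "AE x in M. \<forall>n. \<psi> n (T g x) = g <# \<psi> n x"
      using \<psi>(1) g by (simp add: AE_all_countable level_map_def)
    \<comment> \<open>Both \<open>x\<close> and \<open>T g x\<close> must avoid the default;
      \<open>AE_T\<close> ensures this for the translate.\<close>
    then show "AE x in M. \<phi> (T g x) = act g (\<phi> x)"
      using AE_E AE_T[OF g AE_E]
      by eventually_elim (auto simp: \<phi>_def odometer_action_def E_def)
  qed
qed

end

section \<open>The image measure on the odometer\<close>

theorem theorem3p9:
  fixes G :: "('g, 'b) monoid_scheme" (structure)
    and M :: "'x measure"
    and T :: "'g \<Rightarrow> 'x \<Rightarrow> 'x"
    and \<Gamma> :: "nat \<Rightarrow> 'g set"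
  assumes "group G" and "countable (carrier G)" and "infinite (carrier G)"
    and "residually_finite G"
    and "prob_space M" and "standard_borel M" and "nonatomic M"
    and "nonsingular_system G M T" and "ergodic G M T"
    and "\<And>n. subgroup (\<Gamma> n) G" and "\<And>n. finite (lcosets \<Gamma> n)"
    and "\<And>n. \<Gamma> (Suc n) \<subset> \<Gamma> n"
    and "(\<Inter>n. \<Inter>g\<in>carrier G. g <# \<Gamma> n #> inv g) = {\<one>}"
    and "\<And>n. has_homogeneous_factor G M T (\<Gamma> n)"
  shows "\<exists>\<nu>. ergodic_odometer_measure G \<Gamma> \<nu> \<and>
             is_factor G M T \<nu> (odometer_action G \<Gamma>) \<and>
             ((\<forall>y\<in>odometer_space G \<Gamma>.
                 infinite (stabilizer G (odometer_action G \<Gamma>) y) \<longrightarrow>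
                 \<not> has_homogeneous_factor G M T (stabilizer G (odometer_action G \<Gamma>) y))
              \<longrightarrow> nonsingular_odometer G \<Gamma> \<nu>)"
proof -
  interpret odometer_factors G M T \<Gamma>
  proof (intro odometer_factors.intro odometer_factors_axioms.intro ergodic_nonsingular_action.intro
      ergodic_nonsingular_action_axioms.intro odometer_chain.intro odometer_chain_axioms.intro)
    show "\<Gamma> (Suc n) \<subseteq> \<Gamma> n" for n
      using assms(12)[of n] by (rule psubset_imp_subset)
  qed (rule assms)+
  obtain \<phi> where \<phi>: "\<phi> \<in> measurable M borel_odometer"
    and equivariant: "\<And>g. g \<in> carrier G \<Longrightarrow> AE x in M. \<phi> (T g x) = act g (\<phi> x)"
    using ex_odometer_map by blast
  define \<nu> where "\<nu> = distr M borel_odometer \<phi>"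
  have act: "group_action G (space borel_odometer) act"
    by (simp add: group_action_odometer)
  have factor: "is_factor G M T \<nu> act" and "ergodic G \<nu> act"
    unfolding \<nu>_def
    using image_measure_factor[OF act odometer_action_measurable \<phi> equivariant] by blast+
  then have erg: "ergodic_odometer_measure G \<Gamma> \<nu>"
    by (auto simp: ergodic_odometer_measure_def is_factor_def \<nu>_def sets_borel_odometer)
  moreover have "nonatomic \<nu>"
    if no_factor: "\<forall>y\<in>Y. infinite (stabilizer G act y) \<longrightarrow> \<not> has_homogeneous_factor G M T (stabilizer G act y)"
  proof (rule ccontr)
    assume "\<not> nonatomic \<nu>"
    then obtain y where y: "y \<in> Y" "emeasure \<nu> {y} \<noteq> 0"
      using atom_contains_point[of \<nu>] by (auto simp: \<nu>_def)
    \<comment> \<open>The mass of \<open>y\<close> under the image measure is the measure of its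
      fibre, so both results on stabilizers of atoms apply and contradict
      \<open>no_factor\<close>.\<close>
    then have "emeasure M (\<phi> -` {y} \<inter> space M) \<noteq> 0"
      using \<phi> singleton_in_borel by (simp add: \<nu>_def emeasure_distr)
    then have "infinite (stabilizer G act y)" "has_homogeneous_factor G M T (stabilizer G act y)"
      using infinite_stabilizer_of_atom[OF act \<phi> equivariant] homogeneous_factor_of_atom[OF act \<phi> equivariant]
        singleton_in_borel y(1) assms(7) by auto
    then show False
      using no_factor y(1) by blast
  qed
  ultimately show ?thesis
    using factor by (auto simp: nonsingular_odometer_def)
qed

end
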